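(* Let $k\ge 3$ and $0\le\alpha<1$. Let $G$ be a connected $k$-uniform hypergraph on $n$ vertices with $m$ edges, with maximum degree $\Delta$ and minimum degree $\delta$. Let $i,j\in V(G)$ with $i\ne j$, $d_i=\Delta$ and $d_j=\delta$. Put $c=1$ if $i$ and $j$ are not adjacent and $c=k$ if $i$ and $j$ are adjacent. Then $$\rho_{\alpha}(G)-\frac{km}{n}\ \ge\ \frac{\alpha}{cn}\left(2\,\frac{\Delta^{\frac{2k-1}{k-1}}+\delta^{\frac{2k-1}{k-1}}}{\Delta^{\frac{k}{k-1}}+\delta^{\frac{k}{k-1}}}-(\Delta+\delta)\right)+\frac{(1-\alpha)k}{cn}\left(2^{\frac1k}\left(\Delta^{\frac{k}{k-1}}+\delta^{\frac{k}{k-1}}\right)^{\frac{k-1}{k}}-(\Delta+\delta)\right)$$ and the right-hand side above is greater than or equal to $$\frac{\alpha}{cn}\left(\frac{\Delta^{\frac{2k-1}{k-1}}+\delta^{\frac{2k-1}{k-1}}}{\Delta^{\frac{k}{k-1}}}-(\Delta+\delta)\right)+\frac{(1-\alpha)k}{cn}\left(2^{\frac1k}\left(\Delta^{\frac{k}{k-1}}+\delta^{\frac{k}{k-1}}\right)^{\frac{k-1}{k}}-(\Delta+\delta)\right).$$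
   Context: A $k$-uniform hypergraph $G=(V(G),E(G))$ has a finite vertex set $V(G)$ (identified with $[n]=\{1,\dots,n\}$) and an edge set $E(G)$ consisting of distinct $k$-element subsets of $V(G)$; hypergraphs are assumed to have at least one edge. The degree $d_i$ of a vertex $i$ is the number of edges containing $i$. Two distinct vertices are adjacent if some edge contains both. $G$ is connected if every two vertices $u,v$ are joined by a sequence $u=v_1,e_1,v_2,\dots,e_\ell,v_{\ell+1}=v$ with $e_t\in E(G)$ and $\{v_t,v_{t+1}\}\subseteq e_t$. The adjacency tensor $\mathcal{A}(G)$ is the tensor of order $k$ and dimension $n$ with entries $a_{i_1\ldots i_k}=\frac{1}{(k-1)!}$ if $\{i_1,\dots,i_k\}\in E(G)$ and $0$ otherwise; $\mathcal{D}(G)$ is the diagonal tensor of order $k$ and dimension $n$ with diagonal entries $d_{i\ldots i}=d_i$ and all other entries $0$. For $0\le\alpha<1$, $\mathcal{A}_\alpha(G)=\alpha\mathcal{D}(G)+(1-\alpha)\mathcal{A}(G)$. For a tensor $\mathcal{T}=(t_{i_1\ldots i_k})$ of order $k$ and dimension $n$ and $x\in\mathbb{C}^n$, $(\mathcal{T}x)_i=\sum_{i_2,\dots,i_k=1}^n t_{ii_2\ldots i_k}x_{i_2}\cdots x_{i_k}$. A number $\lambda\in\mathbb{C}$ is an eigenvalue of $\mathcal{T}$ with eigenvector $0\ne x\in\mathbb{C}^n$ if $(\mathcal{T}x)_i=\lambda x_i^{k-1}$ for all $i$; the spectral radius $\rho(\mathcal{T})$ is the maximum of $|\lambda|$ over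 eigenvalues $\lambda$ of $\mathcal{T}$. $\rho_\alpha(G)=\rho(\mathcal{A}_\alpha(G))$. *)

theory Defs
  imports Complex_Main
begin

definition uniform_hypergraph :: "nat \<Rightarrow> 'a set \<Rightarrow> 'a set set \<Rightarrow> bool" where
  "uniform_hypergraph k V E \<longleftrightarrow>
     finite V \<and> E \<noteq> {} \<and> (\<forall>e\<in>E. e \<subseteq> V \<and> card e = k)"

definition hg_degree :: "'a set set \<Rightarrow> 'a \<Rightarrow> nat" where
  "hg_degree E v = card {e \<in> E. v \<in> e}"

definition hg_max_degree :: "'a set \<Rightarrow> 'a set set \<Rightarrow> nat" where
  "hg_max_degree V E = Max (hg_degree E ` V)"

definition hg_min_degree :: "'a set \<Rightarrow> 'a set set \<Rightarrow> nat" where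
  "hg_min_degree V E = Min (hg_degree E ` V)"

definition hg_adjacent :: "'a set set \<Rightarrow> 'a \<Rightarrow> 'a \<Rightarrow> bool" where
  "hg_adjacent E u v \<longleftrightarrow> u \<noteq> v \<and> (\<exists>e\<in>E. u \<in> e \<and> v \<in> e)"

definition hg_connected :: "'a set \<Rightarrow> 'a set set \<Rightarrow> bool" where
  "hg_connected V E \<longleftrightarrow>
     (\<forall>u\<in>V. \<forall>v\<in>V. \<exists>vs es.
        set vs \<subseteq> V \<and> set es \<subseteq> E \<and> length vs = length es + 1 \<and>
        hd vs = u \<and> last vs = v \<and>
        (\<forall>t<length es. {vs ! t, vs ! Suc t} \<subseteq> es ! t))"

text \<open>
  A tensor of order \<open>k\<close> indexed by a finite set \<open>V\<close> (so of dimension \<open>card V\<close>) is given by its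
  entries at the index lists of length \<open>k\<close> over \<open>V\<close>; values at other lists are irrelevant.
  Likewise, only the restriction to \<open>V\<close> of a vector \<open>x :: 'a \<Rightarrow> complex\<close> matters.
\<close>
type_synonym 'a tensor = "'a list \<Rightarrow> complex"

definition tensor_apply :: "'a set \<Rightarrow> nat \<Rightarrow> 'a tensor \<Rightarrow> ('a \<Rightarrow> complex) \<Rightarrow> 'a \<Rightarrow> complex" where
  "tensor_apply V k T x i =
     (\<Sum>js | set js \<subseteq> V \<and> length js = k - 1. T (i # js) * prod_list (map x js))"

definition tensor_eigenvalue :: "'a set \<Rightarrow> nat \<Rightarrow> 'a tensor \<Rightarrow> complex \<Rightarrow> bool" where
  "tensor_eigenvalue V k T \<mu> \<longleftrightarrow>
     (\<exists>x. (\<exists>i\<in>V. x i \<noteq> 0) \<and> (\<forall>i\<in>V. tensor_apply V k T x i = \<mu> * x i ^ (k - 1)))"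

definition tensor_spectral_radius :: "'a set \<Rightarrow> nat \<Rightarrow> 'a tensor \<Rightarrow> real" where
  "tensor_spectral_radius V k T = (GREATEST r. \<exists>\<mu>. tensor_eigenvalue V k T \<mu> \<and> r = cmod \<mu>)"

text \<open>For an index list of length \<open>k\<close>, \<open>set js \<in> E\<close> forces the \<open>k\<close> indices to be distinct,
  since all edges have \<open>k\<close> elements.\<close>
definition adjacency_tensor :: "nat \<Rightarrow> 'a set set \<Rightarrow> 'a tensor" where
  "adjacency_tensor k E js = (if set js \<in> E then 1 / fact (k - 1) else 0)"

definition degree_tensor :: "nat \<Rightarrow> 'a set set \<Rightarrow> 'a tensor" where
  "degree_tensor k E js =
     (if js = replicate k (hd js) then of_nat (hg_degree E (hd js)) else 0)"

definition alpha_tensor :: "real \<Rightarrow> nat \<Rightarrow> 'a set set \<Rightarrow> 'a tensor" where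
  "alpha_tensor \<alpha> k E js =
     of_real \<alpha> * degree_tensor k E js + of_real (1 - \<alpha>) * adjacency_tensor k E js"

definition alpha_spectral_radius :: "real \<Rightarrow> nat \<Rightarrow> 'a set \<Rightarrow> 'a set set \<Rightarrow> real" where
  "alpha_spectral_radius \<alpha> k V E = tensor_spectral_radius V k (alpha_tensor \<alpha> k E)"

end

theory Submission
  imports Defs "HOL-Analysis.Function_Topology" "HOL-Combinatorics.Multiset_Permutations"
begin

text \<open>
  On nonnegative vectors with \<open>\<Sum>v. x v ^ k = 1\<close> the homogeneous form of the tensor attains a
  maximum. A maximizer is an eigenvector, and since the tensor is symmetric and nonnegative, every
  eigenvalue \<open>\<mu>\<close> satisfies \<open>cmod \<mu> \<le>\<close> this maximum (multiply the eigenvalue equation by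
  \<open>cmod (x i)\<close> and sum over \<open>i\<close>). So the spectral radius is bounded below by Rayleigh quotients.
  The test vector is 1 except at \<open>i\<close> and \<open>j\<close>, where it is \<open>s\<close> and \<open>t\<close> with
  \<open>s ^ k + t ^ k = 2\<close>, chosen to give equality in Hoelder's inequality for \<open>\<Delta> * s + \<delta> * t\<close>;
  if \<open>i\<close> and \<open>j\<close> are adjacent, these two entries are first averaged towards 1.
\<close>

text \<open>This is the sum over \<open>v\<close> of \<open>x v\<close> times component
  \<open>v\<close> of the tensor applied to \<open>x\<close>. The factor \<open>k\<close> is the
  number of orderings \<open>k!\<close> of an edge divided by the normalization
  \<open>(k - 1)!\<close>.\<close>

definition alpha_form :: "real \<Rightarrow> nat \<Rightarrow> 'a set \<Rightarrow> 'a set set \<Rightarrow> ('a \<Rightarrow> real) \<Rightarrow> real" where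
  "alpha_form \<alpha> k V E x =
     \<alpha> * (\<Sum>v\<in>V. real (hg_degree E v) * x v ^ k) + (1 - \<alpha>) * real k * (\<Sum>e\<in>E. \<Prod>v\<in>e. x v)"

section \<open>Real inequalities\<close>

text \<open>This is AM-GM for two copies of \<open>u ^ k\<close> and \<open>k - 2\<close> ones. In
  the induction, the right side grows by at least \<open>u ^ 2\<close> because the surplus factors
  as \<open>(u - 1) * (2 * u ^ k - u - 1)\<close>, whose factors never have opposite signs.\<close>

lemma double_power2_le:
  fixes u :: real
  assumes "u \<ge> 0" "k \<ge> 2"
  shows "real k * u ^ 2 \<le> 2 * u ^ k + real k - 2"
  using assms(2)
proof (induction k rule: dec_induct)
  case (step k)
  have "(u - 1) * (2 * u ^ k - u - 1) \<ge> 0"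
  proof (cases "u \<ge> 1")
    case True
    then have "u ^ 1 \<le> u ^ k"
      using step by (intro power_increasing) auto
    with True show ?thesis by (intro mult_nonneg_nonneg) auto
  next
    case False
    then have "u ^ k \<le> u ^ 1"
      using step assms by (intro power_decreasing) auto
    with False show ?thesis by (intro mult_nonpos_nonpos) auto
  qed
  then have "2 * u ^ Suc k - 2 * u ^ k - u ^ 2 + 1 \<ge> 0"
    by (simp add: algebra_simps power2_eq_square)
  then show ?case using step.IH by (simp add: algebra_simps)
qed auto

text \<open>AM-GM for \<open>u ^ k\<close>, \<open>v ^ k\<close> and \<open>k - 2\<close> ones,
  reduced to the case of equal arguments by \<open>2 * u * v \<le> u ^ 2 + v ^ 2\<close>.\<close>

lemma product_le_powers:
  fixes u v :: real
  assumes "u \<ge> 0" "v \<ge> 0" "k \<ge> 2"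
  shows "real k * (u * v) \<le> u ^ k + v ^ k + real k - 2"
proof -
  have "2 * (u * v) \<le> u ^ 2 + v ^ 2"
    using sum_squares_bound[of u v] by simp
  then have "real k * (2 * (u * v)) \<le> real k * (u ^ 2 + v ^ 2)"
    by (intro mult_left_mono) auto
  then show ?thesis
    using double_power2_le[OF assms(1,3)] double_power2_le[OF assms(2,3)]
    by (simp add: algebra_simps)
qed

text \<open>The three-factor Hoelder inequality for the vectors \<open>(s\<^sup>k, 1, 1, \<dots>, 1)\<close>,
  \<open>(1, t\<^sup>k, 1, \<dots>, 1)\<close> and \<open>(1, \<dots>, 1)\<close> of length \<open>k\<close>, with exponents
  \<open>1/k\<close>, \<open>1/k\<close> and \<open>(k - 2)/k\<close>.\<close>
lemma product_ge_shift:
  fixes s t p q :: real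
  assumes "s \<ge> 0" "t \<ge> 0" "p > 0" "q > 0" "k \<ge> 2"
    and p: "real k * p ^ k = s ^ k + real k - 1"
    and q: "real k * q ^ k = t ^ k + real k - 1"
  shows "real k * (p * q) \<ge> s + t + real k - 2"
proof -
  \<comment> \<open>As in the usual proof of Hoelder's inequality, the vectors are normalized by
    \<open>p\<close> and \<open>q\<close> and AM-GM is applied in each coordinate: first the one
    with \<open>s\<close>, then the one with \<open>t\<close>, then the \<open>k - 2\<close> equal
    ones.\<close>
  have "real k * (s / p * (1 / q)) \<le> (s / p) ^ k + (1 / q) ^ k + real k - 2"
    using assms by (intro product_le_powers) auto
  moreover have "real k * (1 / p * (t / q)) \<le> (1 / p) ^ k + (t / q) ^ k + real k - 2"
    using assms by (intro product_le_powers) auto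
  moreover have "(real k - 2) * (real k * (1 / p * (1 / q)))
      \<le> (real k - 2) * ((1 / p) ^ k + (1 / q) ^ k + real k - 2)"
    using assms by (intro mult_left_mono product_le_powers) auto
  ultimately have "real k * (s / p * (1 / q)) + real k * (1 / p * (t / q))
      + (real k - 2) * (real k * (1 / p * (1 / q)))
      \<le> ((s / p) ^ k + (1 / q) ^ k + real k - 2) + ((1 / p) ^ k + (t / q) ^ k + real k - 2)
        + (real k - 2) * ((1 / p) ^ k + (1 / q) ^ k + real k - 2)"
    by (intro add_mono)
  \<comment> \<open>Over each denominator stand one perturbed power and \<open>k - 1\<close> ones.
    By the choice of \<open>p\<close> and \<open>q\<close> each of the two quotients equals
    \<open>k\<close>.\<close>
  also have "\<dots> = (s ^ k + real k - 1) / p ^ k + (t ^ k + real k - 1) / q ^ k + real k * (real k - 2)"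
    by (simp add: power_divide add_divide_distrib diff_divide_distrib algebra_simps)
  also have "\<dots> = real k * real k"
    unfolding p[symmetric] q[symmetric] using assms(3,4) by (simp add: algebra_simps)
  also have "real k * (s / p * (1 / q)) + real k * (1 / p * (t / q))
      + (real k - 2) * (real k * (1 / p * (1 / q))) = real k * ((s + t + real k - 2) / (p * q))"
    by (simp add: add_divide_distrib diff_divide_distrib algebra_simps)
  finally have "real k * ((s + t + real k - 2) / (p * q)) \<le> real k * real k" .
  then have "(s + t + real k - 2) / (p * q) \<le> real k"
    by (rule mult_left_le_imp_le) (use assms(5) in simp)
  then show ?thesis
    using assms(3,4) by (simp add: pos_divide_le_eq)
qed

text \<open>For \<open>t > 0\<close> this is the vanishing of the derivative at an interior maximum.
  For \<open>t = 0\<close> the maximum value forces \<open>c = 0\<close>, and a positive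
  \<open>b\<close> would make the linear term dominate \<open>a * s ^ k\<close> for small
  \<open>s\<close>, so \<open>b = 0\<close>.\<close>

lemma critical_point_power:
  fixes a b c t :: real
  assumes max: "\<And>s. s \<ge> 0 \<Longrightarrow> a * s ^ k + b * s + c \<le> 0"
    and t: "t \<ge> 0" "a * t ^ k + b * t + c = 0" and "b \<ge> 0" "k \<ge> 2"
  shows "real k * a * t ^ (k - 1) + b = 0"
proof (cases "t = 0")
  case False
  have "((\<lambda>s. a * s ^ k + b * s + c) has_real_derivative (real k * a * t ^ (k - 1) + b)) (at t)"
    by (auto intro!: derivative_eq_intros)
  moreover have "\<forall>s. \<bar>t - s\<bar> < t \<longrightarrow> a * s ^ k + b * s + c \<le> a * t ^ k + b * t + c"
    using max t by auto
  ultimately show ?thesis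
    using False t by (intro DERIV_local_max[of _ _ t t]) auto
next
  case True
  then have c: "c = 0" using t \<open>k \<ge> 2\<close> by (simp add: power_0_left)
  have "b = 0"
  proof (rule ccontr)
    assume "b \<noteq> 0"
    with \<open>b \<ge> 0\<close> have b: "b > 0" by simp
    \<comment> \<open>The bound 1 gives \<open>s ^ k \<le> s ^ 2\<close>; the other bound keeps
      \<open>\<bar>a\<bar> * s\<close> below \<open>b\<close>.\<close>
    define s where "s = min 1 (b / (2 * (\<bar>a\<bar> + 1)))"
    have s: "s > 0" "s \<le> 1" "s \<le> b / (2 * (\<bar>a\<bar> + 1))"
      using b unfolding s_def by auto
    have "s ^ k \<le> s ^ 2" using s \<open>k \<ge> 2\<close> by (intro power_decreasing) auto
    then have "\<bar>a\<bar> * s ^ k \<le> \<bar>a\<bar> * s ^ 2" by (intro mult_left_mono) auto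
    moreover have "- \<bar>a\<bar> * s ^ k \<le> a * s ^ k"
      using s by (intro mult_right_mono) auto
    ultimately have "b * s \<le> \<bar>a\<bar> * s ^ 2"
      using max[of s] s c by simp
    then have "b \<le> \<bar>a\<bar> * s" using s by (simp add: power2_eq_square)
    also have "\<dots> \<le> (\<bar>a\<bar> + 1) * s" using s by (intro mult_right_mono) auto
    also have "\<dots> \<le> b / 2" using s(3) by (simp add: field_simps)
    finally show False using b by simp
  qed
  with True \<open>k \<ge> 2\<close> show ?thesis by simp
qed

text \<open>The exponent \<open>k / (k - 1)\<close> is conjugate to \<open>k\<close>, that is, equal
  to \<open>1 + 1 / (k - 1)\<close>. This collapses the linear form at the extremal point to a
  multiple of \<open>A + B\<close>.\<close>

lemma powr_conjugate_exponent:
  fixes x :: real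
  assumes "x \<ge> 0" "k \<ge> 2"
  shows "x * (x powr (real k / (real k - 1))) powr (1 / real k) = x powr (real k / (real k - 1))"
proof -
  have "real k / (real k - 1) * (1 / real k) = 1 / (real k - 1)"
    using assms by simp
  then have "x * (x powr (real k / (real k - 1))) powr (1 / real k) = x powr 1 * x powr (1 / (real k - 1))"
    using assms by (simp only: powr_powr powr_one)
  also have "\<dots> = x powr (1 + 1 / (real k - 1))"
    by (simp only: powr_add)
  also have "1 + 1 / (real k - 1) = real k / (real k - 1)"
    using assms by (simp add: field_simps)
  finally show ?thesis .
qed

lemma powr_shift_exponent:
  fixes x :: real
  assumes "x \<ge> 0" "k \<ge> 2"
  shows "x powr ((2 * real k - 1) / (real k - 1)) = x * x powr (real k / (real k - 1))"
proof -
  have "(2 * real k - 1) / (real k - 1) = 1 + real k / (real k - 1)"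
    using assms by (simp add: field_simps)
  then show ?thesis
    using assms by (simp only: powr_add powr_one)
qed

text \<open>The point where \<open>a * s + b * t\<close> attains its maximum on the curve \<open>s ^ k + t ^ k = 2\<close>.\<close>
lemma hoelder_equality_case:
  fixes a b :: real and k :: nat
  defines "A \<equiv> a powr (real k / (real k - 1))" and "B \<equiv> b powr (real k / (real k - 1))"
  assumes "a > 0" "b \<ge> 0" "k \<ge> 2"
  obtains s t where "s \<ge> 0" "t \<ge> 0" "s ^ k + t ^ k = 2"
    "a * s ^ k + b * t ^ k
      = 2 * ((a powr ((2 * real k - 1) / (real k - 1)) + b powr ((2 * real k - 1) / (real k - 1))) / (A + B))"
    "a * s + b * t = 2 powr (1 / real k) * (A + B) powr ((real k - 1) / real k)"
proof -
  have A: "A > 0" and B: "B \<ge> 0" using assms by (auto simp: A_def B_def)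
  \<comment> \<open>Equality in Hoelder's inequality needs \<open>s ^ k\<close> and
    \<open>t ^ k\<close> proportional to \<open>A\<close> and \<open>B\<close>; the factor 2
    normalizes their sum.\<close>
  define s where "s = root k (2 * A / (A + B))"
  define t where "t = root k (2 * B / (A + B))"
  have sk: "s ^ k = 2 * A / (A + B)" and tk: "t ^ k = 2 * B / (A + B)"
    using A B assms by (auto simp: s_def t_def)
  have root: "root k (2 * C / (A + B)) = 2 powr (1 / real k) * C powr (1 / real k) / (A + B) powr (1 / real k)"
    if "C \<ge> 0" for C
    using A B that assms by (simp add: root_powr_inverse powr_divide powr_mult)
  have "a * s + b * t = 2 powr (1 / real k) * (a * A powr (1 / real k) + b * B powr (1 / real k))
      / (A + B) powr (1 / real k)"
    unfolding s_def t_def using A B root[of A] root[of B] by (simp add: add_divide_distrib algebra_simps)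
  also have "\<dots> = 2 powr (1 / real k) * ((A + B) powr 1 / (A + B) powr (1 / real k))"
    using A B assms powr_conjugate_exponent[of a k] powr_conjugate_exponent[of b k]
    by (simp add: A_def B_def)
  also have "\<dots> = 2 powr (1 / real k) * (A + B) powr (1 - 1 / real k)"
    by (simp only: powr_diff)
  also have "1 - 1 / real k = (real k - 1) / real k"
    using assms by (simp add: field_simps)
  finally have lin: "a * s + b * t = 2 powr (1 / real k) * (A + B) powr ((real k - 1) / real k)" .
  show ?thesis
  proof (rule that[of s t])
    show "s \<ge> 0" "t \<ge> 0" using A B assms by (auto simp: s_def t_def)
    show "s ^ k + t ^ k = 2"
    proof -
      have "s ^ k + t ^ k = 2 * ((A + B) / (A + B))"
        unfolding sk tk by (simp only: add_divide_distrib distrib_left times_divide_eq_right)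
      then show ?thesis using A B by simp
    qed
    show "a * s ^ k + b * t ^ k
      = 2 * ((a powr ((2 * real k - 1) / (real k - 1)) + b powr ((2 * real k - 1) / (real k - 1))) / (A + B))"
    proof -
      have "a powr ((2 * real k - 1) / (real k - 1)) = a * A"
        "b powr ((2 * real k - 1) / (real k - 1)) = b * B"
        using assms(3-5) powr_shift_exponent[of a k] powr_shift_exponent[of b k]
        by (simp_all only: A_def B_def less_imp_le)
      then show ?thesis
        unfolding sk tk
        by (simp only: add_divide_distrib distrib_left times_divide_eq_right mult.left_commute)
    qed
  qed (rule lin)
qed

section \<open>The spectral radius as the maximum of a homogeneous form\<close>

locale uniform_hypergraph_locale =
  fixes k :: nat and V :: "'a set" and E :: "'a set set"
  assumes uniform: "uniform_hypergraph k V E" and k2: "k \<ge> 2"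
begin

lemma finite_V: "finite V" and E_nonempty: "E \<noteq> {}"
  and edge_subset: "e \<in> E \<Longrightarrow> e \<subseteq> V" and edge_card: "e \<in> E \<Longrightarrow> card e = k"
  using uniform by (auto simp: uniform_hypergraph_def)

lemma finite_edge: "e \<in> E \<Longrightarrow> finite e"
  using finite_V edge_subset finite_subset by blast

lemma finite_E: "finite E"
  using edge_subset by (intro finite_subset[of E "Pow V"]) (auto simp: finite_V)

lemma V_nonempty: "V \<noteq> {}"
proof
  assume "V = {}"
  moreover obtain e where "e \<in> E" using E_nonempty by blast
  ultimately show False using edge_subset[of e] edge_card[of e] k2 by auto
qed

lemma sum_incident_swap:
  "(\<Sum>v\<in>V. \<Sum>e\<in>{e\<in>E. v \<in> e}. f v e) = (\<Sum>e\<in>E. \<Sum>v\<in>e. f v e)"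
proof -
  have "(\<Sum>v\<in>V. \<Sum>e\<in>{e\<in>E. v \<in> e}. f v e) = (\<Sum>e\<in>E. \<Sum>v\<in>{v\<in>V. v \<in> e}. f v e)"
    using finite_V finite_E by (rule sum.swap_restrict)
  also have "\<dots> = (\<Sum>e\<in>E. \<Sum>v\<in>e. f v e)"
    using edge_subset by (intro sum.cong) auto
  finally show ?thesis .
qed

lemma sum_degree: "(\<Sum>v\<in>V. real (hg_degree E v)) = real k * real (card E)"
  using sum_incident_swap[of "\<lambda>_ _. 1::real"] edge_card
  by (simp add: hg_degree_def algebra_simps)

text \<open>Multiplying by \<open>x v\<close> restores the factor missing from each edge product,
  and each edge is met once from each of its \<open>k\<close> vertices.\<close>

lemma alpha_form_eq_sum:
  "alpha_form \<alpha> k V E x =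
     (\<Sum>v\<in>V. x v * (\<alpha> * real (hg_degree E v) * x v ^ (k - 1)
        + (1 - \<alpha>) * (\<Sum>e\<in>{e\<in>E. v \<in> e}. \<Prod>w\<in>e - {v}. x w)))"
proof -
  have "(\<Sum>v\<in>V. x v * (\<Sum>e\<in>{e\<in>E. v \<in> e}. \<Prod>w\<in>e - {v}. x w))
      = (\<Sum>v\<in>V. \<Sum>e\<in>{e\<in>E. v \<in> e}. \<Prod>w\<in>e. x w)"
    unfolding sum_distrib_left by (intro sum.cong) (auto simp: prod.remove finite_edge)
  also have "\<dots> = real k * (\<Sum>e\<in>E. \<Prod>w\<in>e. x w)"
    unfolding sum_incident_swap using edge_card by (simp add: sum_distrib_left)
  finally have *: "(\<Sum>v\<in>V. x v * (\<Sum>e\<in>{e\<in>E. v \<in> e}. \<Prod>w\<in>e - {v}. x w))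
      = real k * (\<Sum>e\<in>E. \<Prod>w\<in>e. x w)" .
  have pow: "x v ^ k = x v * x v ^ (k - 1)" for v
    using k2 by (cases k) auto
  have "(\<Sum>v\<in>V. x v * (\<alpha> * real (hg_degree E v) * x v ^ (k - 1)
        + (1 - \<alpha>) * (\<Sum>e\<in>{e\<in>E. v \<in> e}. \<Prod>w\<in>e - {v}. x w)))
     = \<alpha> * (\<Sum>v\<in>V. real (hg_degree E v) * x v ^ k)
       + (1 - \<alpha>) * (\<Sum>v\<in>V. x v * (\<Sum>e\<in>{e\<in>E. v \<in> e}. \<Prod>w\<in>e - {v}. x w))"
    unfolding pow by (simp add: sum.distrib sum_distrib_left algebra_simps)
  then show ?thesis
    unfolding * alpha_form_def by simp
qed

section \<open>The action of the tensors as sums over incident edges\<close>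

lemma tensor_apply_degree:
  assumes "i \<in> V"
  shows "tensor_apply V k (degree_tensor k E) x i = of_nat (hg_degree E i) * x i ^ (k - 1)"
proof -
  have eq: "(i # js = replicate k i) = (js = replicate (k - 1) i)" for js
    using k2 by (cases k) auto
  have "tensor_apply V k (degree_tensor k E) x i =
      (\<Sum>js | set js \<subseteq> V \<and> length js = k - 1.
        if js = replicate (k - 1) i then of_nat (hg_degree E i) * x i ^ (k - 1) else 0)"
    unfolding tensor_apply_def degree_tensor_def
    by (intro sum.cong) (auto simp: eq prod_list_replicate)
  also have "\<dots> = of_nat (hg_degree E i) * x i ^ (k - 1)"
    using assms finite_lists_length_eq[OF finite_V] by (subst sum.delta) auto
  finally show ?thesis .
qed

text \<open>An edge has \<open>k\<close> elements and \<open>i # js\<close> has \<open>k\<close>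
  entries, so no index can repeat, and \<open>js\<close> enumerates the edge without
  \<open>i\<close>.\<close>

lemma edge_lists_eq:
  assumes "i \<in> V"
  shows "{js. (set js \<subseteq> V \<and> length js = k - 1) \<and> insert i (set js) \<in> E}
    = (\<Union>e\<in>{e\<in>E. i \<in> e}. permutations_of_set (e - {i}))"
proof (intro equalityI subsetI)
  fix js assume "js \<in> {js. (set js \<subseteq> V \<and> length js = k - 1) \<and> insert i (set js) \<in> E}"
  then have js: "length js = k - 1" "insert i (set js) \<in> E" by auto
  have card: "card (insert i (set js)) = k" using js edge_card by blast
  have "i \<notin> set js"
  proof
    assume "i \<in> set js"
    then have "card (set js) = k" using card by (simp add: insert_absorb)
    then show False using card_length[of js] js k2 by simp
  qed
  moreover from this have "distinct js"
    using card js by (intro card_distinct) auto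
  ultimately show "js \<in> (\<Union>e\<in>{e\<in>E. i \<in> e}. permutations_of_set (e - {i}))"
    using js by (intro UN_I[of "insert i (set js)"]) (auto simp: permutations_of_set_def)
next
  fix js assume "js \<in> (\<Union>e\<in>{e\<in>E. i \<in> e}. permutations_of_set (e - {i}))"
  then obtain e where e: "e \<in> E" "i \<in> e" "js \<in> permutations_of_set (e - {i})" by blast
  then have js: "set js = e - {i}" "distinct js" by (auto simp: permutations_of_set_def)
  then have "length js = k - 1"
    using e edge_card finite_edge distinct_card[of js] by (metis card_Diff_singleton)
  moreover have "insert i (set js) = e" using js e by auto
  ultimately show "js \<in> {js. (set js \<subseteq> V \<and> length js = k - 1) \<and> insert i (set js) \<in> E}"
    using js e edge_subset by auto
qed

text \<open>The \<open>(k - 1)!\<close> orderings of \<open>e - {i}\<close> give equal products and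
  cancel the normalization of the tensor.\<close>

lemma tensor_apply_adjacency:
  assumes "i \<in> V"
  shows "tensor_apply V k (adjacency_tensor k E) x i = (\<Sum>e\<in>{e\<in>E. i \<in> e}. \<Prod>w\<in>e - {i}. x w)"
proof -
  let ?L = "{js. set js \<subseteq> V \<and> length js = k - 1}"
  have fin: "finite ?L" using finite_lists_length_eq[OF finite_V] .
  have "tensor_apply V k (adjacency_tensor k E) x i
      = (\<Sum>js\<in>?L. if insert i (set js) \<in> E then prod_list (map x js) / fact (k - 1) else 0)"
    unfolding tensor_apply_def adjacency_tensor_def by (intro sum.cong) auto
  also have "\<dots> = (\<Sum>js\<in>{js\<in>?L. insert i (set js) \<in> E}. prod_list (map x js) / fact (k - 1))"
    by (subst sum.inter_filter[OF fin]) simp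
  also have "{js\<in>?L. insert i (set js) \<in> E} = (\<Union>e\<in>{e\<in>E. i \<in> e}. permutations_of_set (e - {i}))"
    using edge_lists_eq[OF assms] by simp
  also have "(\<Sum>js\<in>\<dots>. prod_list (map x js) / fact (k - 1))
      = (\<Sum>e\<in>{e\<in>E. i \<in> e}. \<Sum>js\<in>permutations_of_set (e - {i}). prod_list (map x js) / fact (k - 1))"
  proof (rule sum.UNION_disjoint)
    show "\<forall>e\<in>{e \<in> E. i \<in> e}. \<forall>f\<in>{e \<in> E. i \<in> e}.
        e \<noteq> f \<longrightarrow> permutations_of_set (e - {i}) \<inter> permutations_of_set (f - {i}) = {}"
      by (auto simp: permutations_of_set_def)
  qed (auto simp: finite_E)
  also have "\<dots> = (\<Sum>e\<in>{e\<in>E. i \<in> e}. \<Prod>w\<in>e - {i}. x w)"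
  proof (intro sum.cong refl)
    fix e assume e: "e \<in> {e\<in>E. i \<in> e}"
    have "prod_list (map x js) = (\<Prod>w\<in>e - {i}. x w)" if "js \<in> permutations_of_set (e - {i})" for js
      using that prod.distinct_set_conv_list[of js x] by (simp add: permutations_of_set_def)
    then have "(\<Sum>js\<in>permutations_of_set (e - {i}). prod_list (map x js) / fact (k - 1))
        = of_nat (card (permutations_of_set (e - {i}))) * ((\<Prod>w\<in>e - {i}. x w) / fact (k - 1))"
      by simp
    also have "card (permutations_of_set (e - {i})) = fact (k - 1)"
      using e finite_edge edge_card by simp
    finally show "(\<Sum>js\<in>permutations_of_set (e - {i}). prod_list (map x js) / fact (k - 1))
        = (\<Prod>w\<in>e - {i}. x w)" by simp
  qed
  finally show ?thesis .
qed

lemma tensor_apply_alpha: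
  assumes "i \<in> V"
  shows "tensor_apply V k (alpha_tensor \<alpha> k E) x i =
    of_real \<alpha> * (of_nat (hg_degree E i) * x i ^ (k - 1))
    + of_real (1 - \<alpha>) * (\<Sum>e\<in>{e\<in>E. i \<in> e}. \<Prod>w\<in>e - {i}. x w)"
proof -
  have "tensor_apply V k (alpha_tensor \<alpha> k E) x i =
      of_real \<alpha> * tensor_apply V k (degree_tensor k E) x i
      + of_real (1 - \<alpha>) * tensor_apply V k (adjacency_tensor k E) x i"
    unfolding tensor_apply_def alpha_tensor_def sum_distrib_left sum.distrib[symmetric]
    by (intro sum.cong) (auto simp: algebra_simps)
  then show ?thesis
    using tensor_apply_degree[OF assms] tensor_apply_adjacency[OF assms] by simp
qed

section \<open>Maximization of the form and the eigenvalue bound\<close>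

lemma alpha_form_cong:
  assumes "\<And>v. v \<in> V \<Longrightarrow> x v = y v"
  shows "alpha_form \<alpha> k V E x = alpha_form \<alpha> k V E y"
proof -
  have "(\<Prod>v\<in>e. x v) = (\<Prod>v\<in>e. y v)" if "e \<in> E" for e
    using that assms edge_subset by (intro prod.cong) auto
  then show ?thesis
    unfolding alpha_form_def using assms by (simp cong: sum.cong)
qed

lemma alpha_form_scale:
  "alpha_form \<alpha> k V E (\<lambda>v. x v / r) = alpha_form \<alpha> k V E x / r ^ k"
proof -
  have "(\<Prod>v\<in>e. x v / r) = (\<Prod>v\<in>e. x v) / r ^ k" if "e \<in> E" for e
    using that edge_card by (simp add: prod_dividef)
  then have "(\<Sum>e\<in>E. \<Prod>v\<in>e. x v / r) = (\<Sum>e\<in>E. (\<Prod>v\<in>e. x v) / r ^ k)"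
    by (intro sum.cong) auto
  moreover have "(\<Sum>v\<in>V. real (hg_degree E v) * (x v / r) ^ k)
      = (\<Sum>v\<in>V. real (hg_degree E v) * x v ^ k / r ^ k)"
    by (simp add: power_divide)
  ultimately show ?thesis
    unfolding alpha_form_def by (simp add: sum_divide_distrib[symmetric] add_divide_distrib)
qed

text \<open>Compactness gives a maximizer among the nonnegative vectors whose \<open>k\<close>-th
  powers sum to 1. Both sides of the last bound are homogeneous of degree \<open>k\<close>, so it
  extends to all nonnegative vectors.\<close>

lemma alpha_form_maximizer:
  obtains x \<rho> where "\<And>v. v \<in> V \<Longrightarrow> x v \<ge> 0" "\<exists>v\<in>V. x v \<noteq> 0"
    "alpha_form \<alpha> k V E x = \<rho> * (\<Sum>v\<in>V. x v ^ k)"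
    "\<And>y. (\<And>v. v \<in> V \<Longrightarrow> y v \<ge> 0) \<Longrightarrow> alpha_form \<alpha> k V E y \<le> \<rho> * (\<Sum>v\<in>V. y v ^ k)"
proof -
  \<comment> \<open>Coordinates outside \<open>V\<close> are pinned to 0, so that the box is compact
    in the product topology over the whole type. The bound 1 inside \<open>V\<close> follows from
    the normalization anyway.\<close>
  define B :: "('a \<Rightarrow> real) set" where "B = PiE UNIV (\<lambda>v. if v \<in> V then {0..1} else {0})"
  define S :: "('a \<Rightarrow> real) set" where "S = {x. (\<Sum>v\<in>V. x v ^ k) = 1}"
  have cont: "continuous_on UNIV (\<lambda>x::'a \<Rightarrow> real. x v)" for v
    by (rule continuous_on_product_coordinates)
  have "compactin (product_topology (\<lambda>_. euclidean) UNIV) B"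
    unfolding B_def by (subst compactin_PiE) auto
  then have "compact B"
    by (simp add: euclidean_product_topology)
  moreover have "closed S"
    unfolding S_def by (intro closed_Collect_eq continuous_intros cont)
  ultimately have "compact (B \<inter> S)" by (rule compact_Int_closed)
  moreover have "B \<inter> S \<noteq> {}"
  proof -
    obtain v0 where v0: "v0 \<in> V" using V_nonempty by blast
    have "(\<Sum>v\<in>V. (if v = v0 then 1 else 0 :: real) ^ k) = (\<Sum>v\<in>V. if v = v0 then 1 else 0)"
      using k2 by (intro sum.cong) auto
    then have "(\<lambda>v. if v = v0 then 1 else 0) \<in> B \<inter> S"
      using v0 finite_V by (auto simp: B_def S_def)
    then show ?thesis by blast
  qed
  moreover have "continuous_on (B \<inter> S) (alpha_form \<alpha> k V E)"
    unfolding alpha_form_def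
    by (rule continuous_on_subset[of UNIV]) (intro continuous_intros cont, simp)
  ultimately obtain x where x: "x \<in> B \<inter> S"
    and max: "\<And>y. y \<in> B \<inter> S \<Longrightarrow> alpha_form \<alpha> k V E y \<le> alpha_form \<alpha> k V E x"
    by (metis continuous_attains_sup)
  define \<rho> where "\<rho> = alpha_form \<alpha> k V E x"
  have le: "alpha_form \<alpha> k V E y \<le> \<rho> * (\<Sum>v\<in>V. y v ^ k)" if y: "\<And>v. v \<in> V \<Longrightarrow> y v \<ge> 0" for y
  proof -
    let ?N = "\<Sum>v\<in>V. y v ^ k"
    have N0: "?N \<ge> 0" using y by (intro sum_nonneg) auto
    show ?thesis
    proof (cases "?N = 0")
      case True
      then have z: "y v = 0" if "v \<in> V" for v
        using that y finite_V k2 by (subst (asm) sum_nonneg_eq_0_iff) auto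
      have "alpha_form \<alpha> k V E y = alpha_form \<alpha> k V E (\<lambda>_. 0)"
        using z by (intro alpha_form_cong) auto
      also have "\<dots> = 0"
        using k2 edge_card by (simp add: alpha_form_def power_0_left)
      finally show ?thesis using True by simp
    next
      case False
      define r where "r = root k ?N"
      have r: "r > 0" "r ^ k = ?N"
        using False N0 k2 by (auto simp: r_def)
      define z where "z v = (if v \<in> V then y v / r else 0)" for v
      have zk: "(\<Sum>v\<in>V. z v ^ k) = 1"
        using r False by (simp add: z_def power_divide sum_divide_distrib[symmetric])
      have "z v \<le> 1" if "v \<in> V" for v
      proof -
        have "z v ^ k \<le> (\<Sum>v\<in>V. z v ^ k)"
          using that finite_V y r by (intro member_le_sum) (auto simp: z_def)
        then show ?thesis
          using zk k2 power_le_one_iff[of "z v" k] y[OF that] r by (auto simp: z_def that)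
      qed
      then have "z \<in> B \<inter> S"
        using zk y r by (auto simp: B_def S_def z_def PiE_def Pi_def)
      then have "alpha_form \<alpha> k V E z \<le> \<rho>" using max \<rho>_def by simp
      moreover have "alpha_form \<alpha> k V E z = alpha_form \<alpha> k V E y / ?N"
        unfolding r(2)[symmetric] alpha_form_scale[symmetric]
        by (intro alpha_form_cong) (simp add: z_def)
      ultimately show ?thesis
        using False N0 by (simp add: field_simps)
    qed
  qed
  show ?thesis
  proof (rule that[of x \<rho>])
    show "x v \<ge> 0" if "v \<in> V" for v
      using x that by (auto simp: B_def PiE_def Pi_def split: if_splits)
    have S: "(\<Sum>v\<in>V. x v ^ k) = 1" using x by (simp add: S_def)
    show "\<exists>v\<in>V. x v \<noteq> 0"
    proof (rule ccontr)
      assume "\<not> ?thesis"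
      then have "(\<Sum>v\<in>V. x v ^ k) = 0" using k2 by simp
      then show False using S by simp
    qed
    show "alpha_form \<alpha> k V E x = \<rho> * (\<Sum>v\<in>V. x v ^ k)" using S \<rho>_def by simp
  qed (rule le)
qed

text \<open>Stationarity in a coordinate with \<open>x i = 0\<close> is a one-sided condition; it yields the
  eigenvalue equation because the form has no term of degree between 1 and \<open>k\<close> in \<open>x i\<close>.\<close>
lemma maximizer_stationary:
  fixes x :: "'a \<Rightarrow> real"
  assumes \<alpha>: "\<alpha> < 1" and x0: "\<And>v. v \<in> V \<Longrightarrow> x v \<ge> 0"
    and eq: "alpha_form \<alpha> k V E x = \<rho> * (\<Sum>v\<in>V. x v ^ k)"
    and max: "\<And>y. (\<And>v. v \<in> V \<Longrightarrow> y v \<ge> 0) \<Longrightarrow> alpha_form \<alpha> k V E y \<le> \<rho> * (\<Sum>v\<in>V. y v ^ k)"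
    and i: "i \<in> V"
  shows "\<alpha> * real (hg_degree E i) * x i ^ (k - 1)
    + (1 - \<alpha>) * (\<Sum>e\<in>{e\<in>E. i \<in> e}. \<Prod>w\<in>e - {i}. x w) = \<rho> * x i ^ (k - 1)"
proof -
  let ?T = "\<Sum>e\<in>{e\<in>E. i \<in> e}. \<Prod>w\<in>e - {i}. x w"
  let ?a = "\<alpha> * real (hg_degree E i) - \<rho>"
  let ?b = "(1 - \<alpha>) * real k * ?T"
  let ?c = "\<alpha> * (\<Sum>v\<in>V - {i}. real (hg_degree E v) * x v ^ k)
    + (1 - \<alpha>) * real k * (\<Sum>e\<in>{e\<in>E. i \<notin> e}. \<Prod>w\<in>e. x w) - \<rho> * (\<Sum>v\<in>V - {i}. x v ^ k)"
  \<comment> \<open>An edge contains \<open>i\<close> at most once, so its product is constant or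
    linear in the coordinate \<open>t\<close>; only the degree term and the norm contribute
    \<open>t ^ k\<close>.\<close>
  have poly: "alpha_form \<alpha> k V E (x(i := t)) - \<rho> * (\<Sum>v\<in>V. (x(i := t)) v ^ k)
      = ?a * t ^ k + ?b * t + ?c" for t
  proof -
    have 1: "(\<Sum>v\<in>V. f v ((x(i := t)) v)) = f i t + (\<Sum>v\<in>V - {i}. f v (x v))"
      for f :: "'a \<Rightarrow> real \<Rightarrow> real"
      using finite_V i by (subst sum.remove[of _ i]) (auto intro!: sum.cong)
    have "(\<Sum>e\<in>E. \<Prod>w\<in>e. (x(i := t)) w)
        = (\<Sum>e\<in>{e\<in>E. i \<in> e}. \<Prod>w\<in>e. (x(i := t)) w) + (\<Sum>e\<in>{e\<in>E. i \<notin> e}. \<Prod>w\<in>e. (x(i := t)) w)"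
      using finite_E by (subst sum.union_disjoint[symmetric]) (auto intro!: sum.cong)
    also have "(\<Sum>e\<in>{e\<in>E. i \<in> e}. \<Prod>w\<in>e. (x(i := t)) w)
        = (\<Sum>e\<in>{e\<in>E. i \<in> e}. t * (\<Prod>w\<in>e - {i}. x w))"
    proof (intro sum.cong refl)
      fix e assume e: "e \<in> {e\<in>E. i \<in> e}"
      then have "(\<Prod>w\<in>e. (x(i := t)) w) = t * (\<Prod>w\<in>e - {i}. (x(i := t)) w)"
        using finite_edge by (subst prod.remove[of _ i]) auto
      also have "(\<Prod>w\<in>e - {i}. (x(i := t)) w) = (\<Prod>w\<in>e - {i}. x w)"
        by (intro prod.cong) auto
      finally show "(\<Prod>w\<in>e. (x(i := t)) w) = t * (\<Prod>w\<in>e - {i}. x w)" .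
    qed
    also have "\<dots> = t * ?T" by (simp add: sum_distrib_left)
    also have "(\<Sum>e\<in>{e\<in>E. i \<notin> e}. \<Prod>w\<in>e. (x(i := t)) w) = (\<Sum>e\<in>{e\<in>E. i \<notin> e}. \<Prod>w\<in>e. x w)"
      by (intro sum.cong prod.cong) auto
    finally show ?thesis
      unfolding alpha_form_def using 1[of "\<lambda>v z. real (hg_degree E v) * z ^ k"] 1[of "\<lambda>v z. z ^ k"]
      by (simp add: algebra_simps del: fun_upd_apply)
  qed
  have T0: "?T \<ge> 0"
    using x0 edge_subset by (intro sum_nonneg prod_nonneg) blast
  have "real k * ?a * x i ^ (k - 1) + ?b = 0"
  proof (rule critical_point_power[where c = ?c])
    show "?a * s ^ k + ?b * s + ?c \<le> 0" if "s \<ge> 0" for s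
      unfolding poly[symmetric] using max[of "x(i := s)"] x0 that by auto
    show "?a * x i ^ k + ?b * x i + ?c = 0"
      unfolding poly[symmetric] using eq by simp
  qed (use x0 i T0 \<alpha> k2 in auto)
  then have "real k * (?a * x i ^ (k - 1) + (1 - \<alpha>) * ?T) = 0"
    by (simp add: algebra_simps)
  then have "?a * x i ^ (k - 1) + (1 - \<alpha>) * ?T = 0"
    using k2 unfolding mult_eq_0_iff by simp
  then show ?thesis by (simp add: algebra_simps)
qed

text \<open>By the triangle inequality the moduli of an eigenvector satisfy the eigenvalue equation
  as an inequality, with \<open>cmod \<mu>\<close> on the smaller side. Weighting by the moduli and
  summing compares with the form.\<close>

lemma eigenvalue_norm_le:
  assumes \<alpha>: "0 \<le> \<alpha>" "\<alpha> < 1" and eig: "tensor_eigenvalue V k (alpha_tensor \<alpha> k E) \<mu>"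
    and max: "\<And>y. (\<And>v. v \<in> V \<Longrightarrow> y v \<ge> 0) \<Longrightarrow> alpha_form \<alpha> k V E y \<le> \<rho> * (\<Sum>v\<in>V. y v ^ k)"
  shows "cmod \<mu> \<le> \<rho>"
proof -
  obtain x where x: "\<exists>i\<in>V. x i \<noteq> 0"
    "\<And>i. i \<in> V \<Longrightarrow> tensor_apply V k (alpha_tensor \<alpha> k E) x i = \<mu> * x i ^ (k - 1)"
    using eig unfolding tensor_eigenvalue_def by blast
  let ?y = "\<lambda>v. cmod (x v)"
  have pow: "?y v ^ k = ?y v * ?y v ^ (k - 1)" for v
    using k2 by (cases k) auto
  have le: "cmod \<mu> * ?y v ^ (k - 1) \<le> \<alpha> * real (hg_degree E v) * ?y v ^ (k - 1)
      + (1 - \<alpha>) * (\<Sum>e\<in>{e\<in>E. v \<in> e}. \<Prod>w\<in>e - {v}. ?y w)" if v: "v \<in> V" for v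
  proof -
    let ?S = "\<Sum>e\<in>{e\<in>E. v \<in> e}. \<Prod>w\<in>e - {v}. x w"
    have "cmod \<mu> * ?y v ^ (k - 1) = cmod (\<mu> * x v ^ (k - 1))"
      by (simp add: norm_mult norm_power)
    also have "\<mu> * x v ^ (k - 1) = of_real \<alpha> * (of_nat (hg_degree E v) * x v ^ (k - 1))
        + of_real (1 - \<alpha>) * ?S"
      using x(2)[OF v] tensor_apply_alpha[OF v] by simp
    also have "cmod \<dots> \<le> cmod (of_real \<alpha> * (of_nat (hg_degree E v) * x v ^ (k - 1)))
        + cmod (of_real (1 - \<alpha>) * ?S)"
      by (rule norm_triangle_ineq)
    also have "\<dots> = \<alpha> * real (hg_degree E v) * ?y v ^ (k - 1) + (1 - \<alpha>) * cmod ?S"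
      using \<alpha> unfolding norm_mult norm_power norm_of_real norm_of_nat by simp
    also have "cmod ?S \<le> (\<Sum>e\<in>{e\<in>E. v \<in> e}. \<Prod>w\<in>e - {v}. ?y w)"
      unfolding prod_norm by (rule norm_sum)
    finally show ?thesis using \<alpha> by (simp add: mult_left_mono)
  qed
  have "cmod \<mu> * (\<Sum>v\<in>V. ?y v ^ k) = (\<Sum>v\<in>V. ?y v * (cmod \<mu> * ?y v ^ (k - 1)))"
    unfolding pow by (simp add: sum_distrib_left algebra_simps)
  also have "\<dots> \<le> alpha_form \<alpha> k V E ?y"
    unfolding alpha_form_eq_sum using le by (intro sum_mono mult_left_mono) auto
  also have "\<dots> \<le> \<rho> * (\<Sum>v\<in>V. ?y v ^ k)" by (rule max) auto
  finally have "cmod \<mu> * (\<Sum>v\<in>V. ?y v ^ k) \<le> \<rho> * (\<Sum>v\<in>V. ?y v ^ k)" .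
  moreover obtain i where "i \<in> V" "x i \<noteq> 0" using x(1) by blast
  then have "(\<Sum>v\<in>V. ?y v ^ k) > 0"
    using finite_V by (intro sum_pos2[of _ i]) auto
  ultimately show ?thesis by simp
qed

text \<open>The maximum \<open>\<rho>\<close> is itself an eigenvalue and bounds the modulus of
  every other one, so the \<open>GREATEST\<close> in the definition of the spectral radius is
  attained at \<open>\<rho>\<close>.\<close>

lemma alpha_form_le_spectral_radius:
  assumes \<alpha>: "0 \<le> \<alpha>" "\<alpha> < 1" and y: "\<And>v. v \<in> V \<Longrightarrow> y v \<ge> 0"
  shows "alpha_form \<alpha> k V E y \<le> alpha_spectral_radius \<alpha> k V E * (\<Sum>v\<in>V. y v ^ k)"
proof -
  obtain x \<rho> where x0: "\<And>v. v \<in> V \<Longrightarrow> x v \<ge> 0" and nz: "\<exists>v\<in>V. x v \<noteq> 0"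
    and eq: "alpha_form \<alpha> k V E x = \<rho> * (\<Sum>v\<in>V. x v ^ k)"
    and max: "\<And>y. (\<And>v. v \<in> V \<Longrightarrow> y v \<ge> 0) \<Longrightarrow> alpha_form \<alpha> k V E y \<le> \<rho> * (\<Sum>v\<in>V. y v ^ k)"
    by (rule alpha_form_maximizer) blast
  have eig: "tensor_eigenvalue V k (alpha_tensor \<alpha> k E) (of_real \<rho>)"
    unfolding tensor_eigenvalue_def
  proof (intro exI[of _ "\<lambda>v. complex_of_real (x v)"] conjI ballI)
    show "\<exists>i\<in>V. complex_of_real (x i) \<noteq> 0" using nz by simp
    fix i assume i: "i \<in> V"
    show "tensor_apply V k (alpha_tensor \<alpha> k E) (\<lambda>v. complex_of_real (x v)) i
        = of_real \<rho> * of_real (x i) ^ (k - 1)"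
      using arg_cong[OF maximizer_stationary[OF \<alpha>(2) x0 eq max i], of complex_of_real]
      unfolding tensor_apply_alpha[OF i] by (simp add: mult.assoc)
  qed
  have bound: "cmod \<mu> \<le> \<rho>" if "tensor_eigenvalue V k (alpha_tensor \<alpha> k E) \<mu>" for \<mu>
    using eigenvalue_norm_le[OF \<alpha> that max] by blast
  \<comment> \<open>Nonnegativity identifies \<open>\<rho>\<close> with the modulus of the
    eigenvalue it represents.\<close>
  have "\<rho> \<ge> 0"
    using bound[OF eig] norm_ge_zero order_trans by blast
  then have "alpha_spectral_radius \<alpha> k V E = \<rho>"
    unfolding alpha_spectral_radius_def tensor_spectral_radius_def
    using eig bound by (intro Greatest_equality) (auto intro!: exI[of _ "complex_of_real \<rho>"])
  then show ?thesis using max y by blast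
qed

section \<open>Perturbing the constant vector at two vertices\<close>

lemma incident_sum_eq_degree: "(\<Sum>e\<in>E. if i \<in> e then a else 0) = real (hg_degree E i) * (a::real)"
  unfolding hg_degree_def using finite_E by (simp add: sum.inter_filter[symmetric])

lemma two_vertex_alpha_form:
  fixes p q s t c \<alpha> :: real and i j :: 'a
  defines "z \<equiv> \<lambda>v. if v = i then p else if v = j then q else 1"
  assumes \<alpha>: "\<alpha> < 1" and ij: "i \<in> V" "j \<in> V" "i \<noteq> j"
    and p: "1 + (s - 1) / c \<le> p" and q: "1 + (t - 1) / c \<le> q"
    and pq: "hg_adjacent E i j \<Longrightarrow> 1 + (s - 1) / c + (t - 1) / c \<le> p * q"
  shows "real k * real (card E)
      + \<alpha> * (real (hg_degree E i) * (p ^ k - 1) + real (hg_degree E j) * (q ^ k - 1))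
      + (1 - \<alpha>) * real k * (real (hg_degree E i) * ((s - 1) / c) + real (hg_degree E j) * ((t - 1) / c))
    \<le> alpha_form \<alpha> k V E z"
proof -
  have "real (hg_degree E v) * z v ^ k = real (hg_degree E v)
      + (if v = i then real (hg_degree E i) * (p ^ k - 1) else 0)
      + (if v = j then real (hg_degree E j) * (q ^ k - 1) else 0)" for v
    using ij by (auto simp: z_def algebra_simps)
  then have deg: "(\<Sum>v\<in>V. real (hg_degree E v) * z v ^ k) = real k * real (card E)
      + real (hg_degree E i) * (p ^ k - 1) + real (hg_degree E j) * (q ^ k - 1)"
    using ij finite_V by (simp add: sum.distrib sum_degree)
  have edge: "1 + (if i \<in> e then (s - 1) / c else 0) + (if j \<in> e then (t - 1) / c else 0) \<le> (\<Prod>v\<in>e. z v)"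
    if e: "e \<in> E" for e
  proof -
    have "(\<Prod>v\<in>e. z v) = (\<Prod>v\<in>e. (if v = i then p else 1) * (if v = j then q else 1))"
      using ij by (intro prod.cong) (auto simp: z_def)
    also have "\<dots> = (if i \<in> e then p else 1) * (if j \<in> e then q else 1)"
      using finite_edge[OF e] by (simp add: prod.distrib prod.delta)
    finally show ?thesis
      using p q pq e ij by (auto simp: hg_adjacent_def)
  qed
  have "real (card E) + real (hg_degree E i) * ((s - 1) / c) + real (hg_degree E j) * ((t - 1) / c)
      = (\<Sum>e\<in>E. 1 + (if i \<in> e then (s - 1) / c else 0) + (if j \<in> e then (t - 1) / c else 0))"
    by (simp only: sum.distrib incident_sum_eq_degree) simp
  also have "\<dots> \<le> (\<Sum>e\<in>E. \<Prod>v\<in>e. z v)"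
    using edge by (rule sum_mono)
  finally have "(1 - \<alpha>) * real k
      * (real (card E) + real (hg_degree E i) * ((s - 1) / c) + real (hg_degree E j) * ((t - 1) / c))
      \<le> (1 - \<alpha>) * real k * (\<Sum>e\<in>E. \<Prod>v\<in>e. z v)"
    using \<alpha> by (intro mult_left_mono) auto
  then show ?thesis
    unfolding alpha_form_def deg by (simp add: algebra_simps)
qed

text \<open>For adjacent \<open>i\<close> and \<open>j\<close> the entries \<open>s\<close> and \<open>t\<close> themselves do not work, since an edge
  through both contributes \<open>s * t\<close> instead of \<open>s + t - 1\<close>. Their \<open>k\<close>-th powers are therefore
  averaged with \<open>k - 1\<close> ones. This is the \<open>k\<close>-th power mean of \<open>k\<close> layers in a \<open>k\<close>-partite
  blow-up of the hypergraph, in which the perturbed copies of \<open>i\<close> and \<open>j\<close> are not adjacent.\<close>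
lemma two_vertex_spectral_bound:
  fixes s t c \<alpha> :: real
  assumes \<alpha>: "0 \<le> \<alpha>" "\<alpha> < 1" and ij: "i \<in> V" "j \<in> V" "i \<noteq> j"
    and st: "s \<ge> 0" "t \<ge> 0" "s ^ k + t ^ k = 2"
    and c: "c = (if hg_adjacent E i j then real k else 1)"
  shows "real k * real (card E)
      + (\<alpha> * (real (hg_degree E i) * (s ^ k - 1) + real (hg_degree E j) * (t ^ k - 1))
        + (1 - \<alpha>) * real k * (real (hg_degree E i) * (s - 1) + real (hg_degree E j) * (t - 1))) / c
    \<le> alpha_spectral_radius \<alpha> k V E * real (card V)"
proof -
  \<comment> \<open>The deviation of \<open>s ^ k\<close> from 1 is scaled by \<open>1 / c\<close>:
    for \<open>c = 1\<close> this returns \<open>s\<close>, for \<open>c = k\<close> it averages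
    \<open>s ^ k\<close> with \<open>k - 1\<close> ones.\<close>
  define p where "p = root k (1 + (s ^ k - 1) / c)"
  define q where "q = root k (1 + (t ^ k - 1) / c)"
  let ?z = "\<lambda>v. if v = i then p else if v = j then q else 1"
  have c1: "c \<ge> 1" using c k2 by auto
  have nonneg: "1 + (r ^ k - 1) / c \<ge> 0" if "r \<ge> 0" for r
    using c1 zero_le_power[OF that, of k] by (simp add: field_simps)
  have p0: "p \<ge> 0" and q0: "q \<ge> 0"
    using st nonneg k2 by (auto simp: p_def q_def)
  have pk: "p ^ k = 1 + (s ^ k - 1) / c" and qk: "q ^ k = 1 + (t ^ k - 1) / c"
    using st nonneg k2 by (auto simp: p_def q_def)
  have "1 + (s - 1) / c \<le> p \<and> 1 + (t - 1) / c \<le> q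
      \<and> (hg_adjacent E i j \<longrightarrow> 1 + (s - 1) / c + (t - 1) / c \<le> p * q)"
  proof (cases "hg_adjacent E i j")
    case False
    then have "p = s" "q = t" "c = 1"
      using c st k2 by (auto simp: p_def q_def real_root_power_cancel)
    then show ?thesis using False by simp
  next
    case True
    then have ck: "c = real k" using c by simp
    have kp: "real k * p ^ k = s ^ k + real k - 1" and kq: "real k * q ^ k = t ^ k + real k - 1"
      unfolding pk qk ck using k2 by (auto simp: field_simps)
    have "real k * p ^ k > 0" "real k * q ^ k > 0"
      unfolding kp kq using k2 zero_le_power[OF st(1), of k] zero_le_power[OF st(2), of k]
      by linarith+
    then have "p \<noteq> 0" "q \<noteq> 0" using k2 by (auto simp: power_0_left)
    then have pos: "p > 0" "q > 0" using p0 q0 by auto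
    have "s + t + real k - 2 \<le> real k * (p * q)"
      using product_ge_shift[OF st(1,2) pos k2 kp kq] .
    \<comment> \<open>Edges through only one of the two vertices are the case where the other entry
      is 1.\<close>
    moreover have "s + 1 + real k - 2 \<le> real k * (p * 1)"
      using pos st k2 kp by (intro product_ge_shift) auto
    moreover have "t + 1 + real k - 2 \<le> real k * (q * 1)"
      using pos st k2 kq by (intro product_ge_shift) auto
    moreover have "1 + (s - 1) / c = (s + 1 + real k - 2) / real k"
      "1 + (t - 1) / c = (t + 1 + real k - 2) / real k"
      "1 + (s - 1) / c + (t - 1) / c = (s + t + real k - 2) / real k"
      unfolding ck using k2 by (simp_all add: field_simps)
    ultimately show ?thesis
      using k2 by (simp add: pos_divide_le_eq mult.commute)
  qed
  then have "real k * real (card E)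
      + \<alpha> * (real (hg_degree E i) * (p ^ k - 1) + real (hg_degree E j) * (q ^ k - 1))
      + (1 - \<alpha>) * real k * (real (hg_degree E i) * ((s - 1) / c) + real (hg_degree E j) * ((t - 1) / c))
    \<le> alpha_form \<alpha> k V E ?z"
    using \<alpha> ij by (intro two_vertex_alpha_form) auto
  also have "\<dots> \<le> alpha_spectral_radius \<alpha> k V E * (\<Sum>v\<in>V. ?z v ^ k)"
    using p0 q0 by (intro alpha_form_le_spectral_radius \<alpha>) auto
  also have "(\<Sum>v\<in>V. ?z v ^ k)
      = (\<Sum>v\<in>V. 1 + (if v = i then p ^ k - 1 else 0) + (if v = j then q ^ k - 1 else 0))"
    using ij by (intro sum.cong) auto
  also have "\<dots> = real (card V) + (p ^ k - 1) + (q ^ k - 1)"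
    using finite_V ij by (simp add: sum.distrib)
  \<comment> \<open>The deviations at \<open>i\<close> and \<open>j\<close> cancel because
    \<open>s ^ k + t ^ k = 2\<close>.\<close>
  also have "\<dots> = real (card V)"
  proof -
    have "t ^ k = 2 - s ^ k" using st(3) by simp
    then show ?thesis
      unfolding pk qk by (simp add: diff_divide_distrib)
  qed
  finally show ?thesis
    unfolding pk qk by (simp add: add_divide_distrib diff_divide_distrib algebra_simps)
qed

section \<open>Comparison of the extreme degrees and assembly of the bounds\<close>

lemma max_degree_pos: "hg_max_degree V E > 0"
proof -
  obtain e where e: "e \<in> E" using E_nonempty by blast
  then have "e \<noteq> {}" using edge_card k2 by fastforce
  then obtain v where v: "v \<in> e" "v \<in> V" using e edge_subset by blast
  then have "0 < hg_degree E v"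
    using e finite_E by (auto simp: hg_degree_def card_gt_0_iff)
  also have "\<dots> \<le> hg_max_degree V E"
    unfolding hg_max_degree_def using v finite_V by (intro Max_ge) auto
  finally show ?thesis .
qed

lemma min_degree_le_max_degree: "hg_min_degree V E \<le> hg_max_degree V E"
proof -
  obtain v where "v \<in> V" using V_nonempty by blast
  then have "hg_min_degree V E \<le> hg_degree E v" "hg_degree E v \<le> hg_max_degree V E"
    unfolding hg_min_degree_def hg_max_degree_def using finite_V by (auto intro: Min_le Max_ge)
  then show ?thesis by simp
qed

end

theorem corollary4p9:
  fixes V :: "'a set" and E :: "'a set set" and i j :: 'a
    and k n m :: nat and \<alpha> \<Delta> \<delta> c :: real
  assumes "k \<ge> 3"
    and "0 \<le> \<alpha>" and "\<alpha> < 1"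
    and "uniform_hypergraph k V E"
    and "hg_connected V E"
    and "card V = n" and "card E = m"
    and "\<Delta> = real (hg_max_degree V E)" and "\<delta> = real (hg_min_degree V E)"
    and "i \<in> V" and "j \<in> V" and "i \<noteq> j"
    and "real (hg_degree E i) = \<Delta>" and "real (hg_degree E j) = \<delta>"
    and "c = (if hg_adjacent E i j then real k else 1)"
  shows
    "alpha_spectral_radius \<alpha> k V E - real k * real m / real n
       \<ge> \<alpha> / (c * real n) *
           (2 * ((\<Delta> powr ((2 * real k - 1) / (real k - 1)) + \<delta> powr ((2 * real k - 1) / (real k - 1)))
                 / (\<Delta> powr (real k / (real k - 1)) + \<delta> powr (real k / (real k - 1))))
            - (\<Delta> + \<delta>))
         + (1 - \<alpha>) * real k / (c * real n) *
           (2 powr (1 / real k)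
              * (\<Delta> powr (real k / (real k - 1)) + \<delta> powr (real k / (real k - 1)))
                  powr ((real k - 1) / real k)
            - (\<Delta> + \<delta>))
     \<and> \<alpha> / (c * real n) *
           (2 * ((\<Delta> powr ((2 * real k - 1) / (real k - 1)) + \<delta> powr ((2 * real k - 1) / (real k - 1)))
                 / (\<Delta> powr (real k / (real k - 1)) + \<delta> powr (real k / (real k - 1))))
            - (\<Delta> + \<delta>))
         + (1 - \<alpha>) * real k / (c * real n) *
           (2 powr (1 / real k)
              * (\<Delta> powr (real k / (real k - 1)) + \<delta> powr (real k / (real k - 1)))
                  powr ((real k - 1) / real k)
            - (\<Delta> + \<delta>))
       \<ge> \<alpha> / (c * real n) *
           ((\<Delta> powr ((2 * real k - 1) / (real k - 1)) + \<delta> powr ((2 * real k - 1) / (real k - 1)))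
              / \<Delta> powr (real k / (real k - 1))
            - (\<Delta> + \<delta>))
         + (1 - \<alpha>) * real k / (c * real n) *
           (2 powr (1 / real k)
              * (\<Delta> powr (real k / (real k - 1)) + \<delta> powr (real k / (real k - 1)))
                  powr ((real k - 1) / real k)
            - (\<Delta> + \<delta>))"
proof -
  interpret uniform_hypergraph_locale k V E
    using assms by unfold_locales auto
  let ?A = "\<Delta> powr (real k / (real k - 1))" and ?B = "\<delta> powr (real k / (real k - 1))"
  let ?X = "\<Delta> powr ((2 * real k - 1) / (real k - 1)) + \<delta> powr ((2 * real k - 1) / (real k - 1))"
  let ?W = "2 * (?X / (?A + ?B))"
  let ?Z = "2 powr (1 / real k) * (?A + ?B) powr ((real k - 1) / real k)"
  let ?\<rho> = "alpha_spectral_radius \<alpha> k V E"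
  have \<Delta>: "\<Delta> > 0" and \<delta>: "0 \<le> \<delta>" "\<delta> \<le> \<Delta>"
    using assms max_degree_pos min_degree_le_max_degree by auto
  have n: "real n > 0"
    using assms finite_V V_nonempty by (auto simp: card_gt_0_iff)
  have c: "c > 0" using assms by simp
  obtain s t where st: "s \<ge> 0" "t \<ge> 0" "s ^ k + t ^ k = 2"
    and W: "\<Delta> * s ^ k + \<delta> * t ^ k = ?W" and Z: "\<Delta> * s + \<delta> * t = ?Z"
    using hoelder_equality_case[OF \<Delta> \<delta>(1) k2] by metis
  have "real k * real m + (\<alpha> * (\<Delta> * (s ^ k - 1) + \<delta> * (t ^ k - 1))
      + (1 - \<alpha>) * real k * (\<Delta> * (s - 1) + \<delta> * (t - 1))) / c \<le> ?\<rho> * real n"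
    using two_vertex_spectral_bound[OF assms(2,3,10,11,12) st assms(15)] assms(6,7,13,14) by simp
  also have "\<Delta> * (s ^ k - 1) + \<delta> * (t ^ k - 1) = ?W - (\<Delta> + \<delta>)"
    unfolding W[symmetric] by (simp add: algebra_simps)
  also have "\<Delta> * (s - 1) + \<delta> * (t - 1) = ?Z - (\<Delta> + \<delta>)"
    unfolding Z[symmetric] by (simp add: algebra_simps)
  finally have "(real k * real m + (\<alpha> * (?W - (\<Delta> + \<delta>)) + (1 - \<alpha>) * real k * (?Z - (\<Delta> + \<delta>))) / c) / real n
      \<le> ?\<rho>"
    using n by (simp only: pos_divide_le_eq)
  then have 1: "\<alpha> / (c * real n) * (?W - (\<Delta> + \<delta>)) + (1 - \<alpha>) * real k / (c * real n) * (?Z - (\<Delta> + \<delta>))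
      \<le> ?\<rho> - real k * real m / real n"
    by (simp only: add_divide_distrib divide_divide_eq_left times_divide_eq_left le_diff_eq add.commute)
  have A: "?A > 0" using \<Delta> by simp
  \<comment> \<open>Since \<open>\<delta> \<le> \<Delta>\<close>, the denominator
    \<open>?A + ?B\<close> is at most \<open>2 * ?A\<close>; this gives the second inequality of the
    theorem.\<close>
  have "?B \<le> ?A" using \<delta> assms(1) by (intro powr_mono2) auto
  then have "?X * (?A + ?B) \<le> ?X * (2 * ?A)"
    by (intro mult_left_mono) auto
  then have "?X / ?A \<le> ?W"
    using A by (simp add: pos_divide_le_eq pos_le_divide_eq add_pos_nonneg algebra_simps)
  then have 2: "\<alpha> / (c * real n) * (?X / ?A - (\<Delta> + \<delta>)) \<le> \<alpha> / (c * real n) * (?W - (\<Delta> + \<delta>))"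
    using assms(2) c n by (intro mult_left_mono) auto
  show ?thesis
    using 1 2 by (intro conjI add_right_mono)
qed

end
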